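(* Let $\{x^k\}$ be the sequence generated by the gradient support projection algorithm (GSPA), with stepsizes $\alpha_k$, for the problem $\min r(x)=\frac12\|Ax-b\|^2$ subject to $x\in S\cap\mathbb{R}^N_+$, where $A\in\mathbb{R}^{M\times N}$, $b\in\mathbb{R}^M$ and $S=\{x\in\mathbb{R}^N:\|x\|_0\le s\}$. Then: (i) $\lim_{k\to\infty}\frac{\|x^{k+1}-x^k\|}{\alpha_k}=0$; (ii) any accumulation point of $\{x^k\}$ is an $\alpha$-stationary point of the problem (for some $\alpha>0$); (iii) $\lim_{k\to\infty}\|\nabla^C_{S\cap\mathbb{R}^N_+}r(x^k)\|=0$.
   Context: $s<M<N$ are positive integers; $\|x\|_0$ is the number of nonzero entries of $x$ and $\mathrm{supp}(x)$ the set of indices of nonzero entries; $\|\cdot\|$ is the Euclidean norm; $L_r=\lambda_{\max}(A^\top A)>0$. Put $\Omega=S\cap\mathbb{R}^N_+$; $P_\Omega(x)$ is the projection $\arg\min_{y\in\Omega}\|x-y\|$ (when it is not a singleton, "$y=P_\Omega(x)$" means that some element is selected). GSPA: Step 0: $x^0=0$, $\Gamma^0=\mathrm{supp}(P_\Omega(A^\top b))$, parameters $0<\alpha_0<\frac1{L_r}$, $0<\sigma\le\frac1{4L_r}$, $0<\beta<1$. For $k=0,1,2,\dots$: Step 1: compute $\tilde x^{k+1}=P_\Omega(x^k-\alpha_0\nabla r(x^k))$. Step 2: if $\mathrm{supp}(\tilde x^{k+1})=\Gamma^k$, set $x^{k+1}=\tilde x^{k+1}$ (with stepsize $\alpha_k=\alpha_0$)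 and $\Gamma^{k+1}=\mathrm{supp}(x^{k+1})$; else set $x^{k+1}=P_\Omega(x^k-\alpha_k\nabla r(x^k))=x^k(\alpha_k)$, $\Gamma^{k+1}=\mathrm{supp}(x^{k+1})$, where $x^k(\alpha)=P_\Omega(x^k-\alpha\nabla r(x^k))$, $\alpha_k=\alpha_0\beta^{m_k}$ and $m_k$ is the smallest positive integer $m$ with $$r(x^k(\alpha_0\beta^m))\le r(x^k)-\frac{\sigma}{2}\,\frac{\|x^k(\alpha_0\beta^m)-x^k\|^2}{(\alpha_0\beta^m)^2}.$$ The practical stopping test ($\|x^{k+1}-x^k\|\le\epsilon$) is disregarded, so that an infinite sequence is generated; it is assumed that the line search in Step 2 always succeeds. A point $x^*\in\Omega$ is an $\alpha$-stationary point if $x^*\in P_\Omega(x^*-\alpha\nabla r(x^* ))$. For $x\in\Omega$, $\nabla^C_\Omega r(x)=\arg\min\{\|d+\nabla r(x)\| : d\in T^C_\Omega(x)\}$, where the Clarke tangent cone $T^C_\Omega(\overline{x})$ is the set of all $d\in\mathbb{R}^N$ such that for every sequence $\{x^k\}\subset\Omega$ with $x^k\to\overline{x}$ and every $\{\lambda_k\}\subset\mathbb{R}_+$ with $\lambda_k\to0$ there exists $\{y^k\}\subset\mathbb{R}^N$ with $y^k\to d$ and $x^k+\lambda_k y^k\in\Omega$ for all $k$. *)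

theory Defs
  imports "HOL-Analysis.Analysis"
begin

definition supp :: "real ^ 'n \<Rightarrow> 'n set" where
  "supp x = {i. x $ i \<noteq> 0}"

definition l0norm :: "real ^ 'n \<Rightarrow> nat" where
  "l0norm x = card (supp x)"

definition sparse_set :: "nat \<Rightarrow> (real ^ 'n) set" where
  "sparse_set s = {x. l0norm x \<le> s}"

definition nonneg_orthant :: "(real ^ 'n) set" where
  "nonneg_orthant = {x. \<forall>i. 0 \<le> x $ i}"

definition feasible :: "nat \<Rightarrow> (real ^ 'n) set" where
  "feasible s = sparse_set s \<inter> nonneg_orthant"

definition objective :: "real ^ 'n ^ 'm \<Rightarrow> real ^ 'm \<Rightarrow> real ^ 'n \<Rightarrow> real" where
  "objective A b x = 1 / 2 * (norm (A *v x - b))\<^sup>2"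

definition gradient :: "('a::real_inner \<Rightarrow> real) \<Rightarrow> 'a \<Rightarrow> 'a" where
  "gradient f x = (THE g. GDERIV f x :> g)"

text \<open>Largest real eigenvalue; it is only used for symmetric matrices, whose eigenvalues are all real.\<close>

definition lambda_max :: "real ^ 'n ^ 'n \<Rightarrow> real" where
  "lambda_max B = Max {l. \<exists>v. v \<noteq> 0 \<and> B *v v = l *\<^sub>R v}"

text \<open>The projection is set-valued: on a nonconvex set nearest points need not be unique.\<close>

definition proj_set :: "'a::real_inner set \<Rightarrow> 'a \<Rightarrow> 'a set" where
  "proj_set C x = {y. is_arg_min (\<lambda>y. norm (x - y)) (\<lambda>y. y \<in> C) y}"

definition stationary :: "'a::real_inner set \<Rightarrow> ('a \<Rightarrow> real) \<Rightarrow> real \<Rightarrow> 'a \<Rightarrow> bool" where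
  "stationary C f a x \<longleftrightarrow> x \<in> C \<and> x \<in> proj_set C (x - a *\<^sub>R gradient f x)"

definition clarke_tangent_cone :: "'a::real_inner set \<Rightarrow> 'a \<Rightarrow> 'a set" where
  "clarke_tangent_cone C xbar =
     {d. \<forall>x l. (\<forall>k. x k \<in> C) \<and> x \<longlonglongrightarrow> xbar \<and> (\<forall>k. 0 \<le> l k) \<and> l \<longlonglongrightarrow> (0::real) \<longrightarrow>
           (\<exists>y. y \<longlonglongrightarrow> d \<and> (\<forall>k::nat. x k + l k *\<^sub>R y k \<in> C))}"

text \<open>The Clarke tangent cone is closed and convex, so there is exactly one minimizer
  and the choice made by \<open>arg_min_on\<close> is immaterial.\<close>

definition clarke_gradient :: "'a::real_inner set \<Rightarrow> ('a \<Rightarrow> real) \<Rightarrow> 'a \<Rightarrow> 'a" where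
  "clarke_gradient C f x = arg_min_on (\<lambda>d. norm (d + gradient f x)) (clarke_tangent_cone C x)"

text \<open>The line search test for the trial point \<open>y\<close> computed from \<open>x\<close> with step \<open>t\<close>.\<close>

definition sufficient_decrease :: "('a::real_normed_vector \<Rightarrow> real) \<Rightarrow> real \<Rightarrow> 'a \<Rightarrow> real \<Rightarrow> 'a \<Rightarrow> bool" where
  "sufficient_decrease f \<sigma> x t y \<longleftrightarrow>
     f y \<le> f x - \<sigma> / 2 * ((norm (y - x))\<^sup>2 / t\<^sup>2)"

text \<open>
  \<open>x\<close> is a sequence of iterates, with stepsizes \<open>\<alpha>\<close>, that the algorithm can generate from the
  parameters \<open>a0\<close>, \<open>\<sigma>\<close>, \<open>\<beta>\<close>. Here \<open>a0\<close> is the initial trial step, which need not be the stepsize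
  \<open>\<alpha> 0\<close> used in the first iteration. The existentially quantified objects are the supports
  \<open>\<Gamma> k\<close> kept by the algorithm and the elements it selects from the projections: \<open>xt k\<close> is the
  point computed from \<open>x k\<close> in Step 1, and \<open>y k t\<close> is the trial point with step \<open>t\<close> at \<open>x k\<close>.
  The selections are arbitrary, and a trial point that is accepted is itself the next iterate.
  The conjunct \<open>\<exists>m>0. \<dots>\<close> says that the line search, when it is entered, succeeds.\<close>

definition gspa_sequence ::
  "real ^ 'n ^ 'm \<Rightarrow> real ^ 'm \<Rightarrow> nat \<Rightarrow> real \<Rightarrow> real \<Rightarrow> real \<Rightarrow> (nat \<Rightarrow> real ^ 'n) \<Rightarrow> (nat \<Rightarrow> real) \<Rightarrow> bool"
where
  "gspa_sequence A b s a0 \<sigma> \<beta> x \<alpha> \<longleftrightarrow>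
     (let C = feasible s; r = objective A b in
      x 0 = 0 \<and>
      (\<exists>\<Gamma> xt y.
        (\<exists>p \<in> proj_set C (transpose A *v b). \<Gamma> 0 = supp p) \<and>
        (\<forall>k. xt k \<in> proj_set C (x k - a0 *\<^sub>R gradient r (x k)) \<and>
             (\<forall>t>0. y k t \<in> proj_set C (x k - t *\<^sub>R gradient r (x k))) \<and>
             (if supp (xt k) = \<Gamma> k
              then \<alpha> k = a0 \<and> x (Suc k) = xt k
              else let accept = (\<lambda>m. sufficient_decrease r \<sigma> (x k) (a0 * \<beta> ^ m) (y k (a0 * \<beta> ^ m)))
                   in (\<exists>m>0. accept m) \<and>
                      \<alpha> k = a0 * \<beta> ^ (LEAST m. 0 < m \<and> accept m) \<and>
                      x (Suc k) = y k (\<alpha> k)) \<and>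
             \<Gamma> (Suc k) = supp (x (Suc k)))))"

definition accumulation_point :: "(nat \<Rightarrow> 'a::topological_space) \<Rightarrow> 'a \<Rightarrow> bool" where
  "accumulation_point x z \<longleftrightarrow> (\<exists>\<phi>::nat \<Rightarrow> nat. strict_mono \<phi> \<and> (x \<circ> \<phi>) \<longlonglongrightarrow> z)"

end

theory Submission
  imports Defs
begin

text \<open>
  With \<open>D k = (x (k + 1) - x k) / \<alpha> k\<close>, every step decreases \<open>r\<close> by at least a fixed multiple of
  \<open>|D k|\<^sup>2\<close>, so \<open>D\<close> tends to \<open>0\<close>. The projection keeps the coordinates that it selects, hence
  \<open>D k\<close> is the negative gradient at \<open>x k\<close> on the support of \<open>x (k + 1)\<close>. As the Clarke tangent cone
  at \<open>x\<close> consists of the vectors supported in the support of \<open>x\<close>, the Clarke gradients tend to \<open>0\<close>.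

  The stepsizes need not be bounded away from \<open>0\<close>, so stationarity of an accumulation point \<open>z\<close> is not
  obtained by passing to the limit in the projection. The gradient vanishes on the support of \<open>z\<close>.
  Suppose that the support has fewer than \<open>s\<close> elements and that the \<open>j\<close>-th partial derivative at \<open>z\<close> is
  negative. Close to \<open>z\<close> the projection does not select \<open>j\<close>, which forces the stepsize to be small and
  the support to stay the same, with \<open>s\<close> elements. By convexity, such a step passes the line search
  only if it does not move. So \<open>x k\<close> minimizes \<open>r\<close> on its support for infinitely many \<open>k\<close>. There are
  finitely many supports and \<open>r\<close> decreases strictly along proper steps, hence \<open>x k = z\<close> for some such
  \<open>k\<close>, although the supports have different sizes.
\<close>

section \<open>The largest eigenvalue and the quadratic objective\<close>

lemma power2_norm_add_scaleR:
  fixes u w :: "'a :: real_inner"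
  shows "(norm (u + t *\<^sub>R w))\<^sup>2 = (norm u)\<^sup>2 + 2 * t * (u \<bullet> w) + t\<^sup>2 * (norm w)\<^sup>2"
  unfolding power2_norm_eq_inner
  by (simp add: inner_simps inner_commute power2_eq_square algebra_simps)

lemma inner_gram:
  fixes A :: "real ^ 'n ^ 'm"
  shows "((transpose A ** A) *v v) \<bullet> w = (A *v v) \<bullet> (A *v w)"
  by (simp only: matrix_vector_mul_assoc[symmetric] transpose_matrix_vector dot_lmul_matrix)

text \<open>Eigenvectors for distinct eigenvalues of a symmetric matrix are orthogonal, and a
  pairwise orthogonal set is finite. Without finiteness the \<open>Max\<close> in
  \<open>lambda_max\<close> would have no useful meaning.\<close>

lemma finite_eigenvalues_gram:
  fixes A :: "real ^ 'n ^ 'm"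
  shows "finite {l. \<exists>v. v \<noteq> 0 \<and> (transpose A ** A) *v v = l *\<^sub>R v}" (is "finite ?E")
proof -
  define V where "V l = (SOME v. v \<noteq> 0 \<and> (transpose A ** A) *v v = l *\<^sub>R v)" for l
  have V: "V l \<noteq> 0" "(transpose A ** A) *v V l = l *\<^sub>R V l" if "l \<in> ?E" for l
    using someI_ex[of "\<lambda>v. v \<noteq> 0 \<and> (transpose A ** A) *v v = l *\<^sub>R v"] that
    unfolding V_def by blast+
  have orth: "V l \<bullet> V l' = 0" if "l \<in> ?E" "l' \<in> ?E" "l \<noteq> l'" for l l'
  proof -
    have "l * (V l \<bullet> V l') = l' * (V l \<bullet> V l')"
      using inner_gram[of A "V l" "V l'"] inner_gram[of A "V l'" "V l"] V(2)[OF that(1)] V(2)[OF that(2)]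
      by (simp add: inner_commute)
    then show ?thesis using \<open>l \<noteq> l'\<close> by simp
  qed
  have "inj_on V ?E"
    using orth V(1) by (metis (no_types, lifting) inj_onI inner_eq_zero_iff)
  moreover have "finite (V ` ?E)"
    by (rule pairwise_orthogonal_imp_finite) (auto simp: pairwise_def orthogonal_def intro!: orth)
  ultimately show ?thesis
    by (rule finite_imageD[rotated])
qed

text \<open>A maximiser of the Rayleigh quotient is a zero of the nonnegative form
  \<open>\<mu> |w|\<^sup>2 - |A w|\<^sup>2\<close>, so the linear part of the form vanishes there and it is an eigenvector.\<close>

lemma norm_matrix_vector_le_lambda_max:
  fixes A :: "real ^ 'n ^ 'm" and v :: "real ^ 'n"
  shows "(norm (A *v v))\<^sup>2 \<le> lambda_max (transpose A ** A) * (norm v)\<^sup>2"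
proof -
  have "continuous_on (sphere 0 1) (\<lambda>v. (norm (A *v v))\<^sup>2)"
    by (intro continuous_intros linear_continuous_on matrix_vector_mul_bounded_linear)
  moreover have "sphere (0 :: real ^ 'n) 1 \<noteq> {}"
    by simp
  ultimately obtain u where "u \<in> sphere 0 1" "\<forall>w\<in>sphere 0 1. (norm (A *v w))\<^sup>2 \<le> (norm (A *v u))\<^sup>2"
    using continuous_attains_sup[OF compact_sphere] by blast
  then have u: "norm u = 1"
    and max: "norm w = 1 \<Longrightarrow> (norm (A *v w))\<^sup>2 \<le> (norm (A *v u))\<^sup>2" for w
    by simp_all
  define \<mu> where "\<mu> = (norm (A *v u))\<^sup>2"
  have bound: "(norm (A *v w))\<^sup>2 \<le> \<mu> * (norm w)\<^sup>2" for w
  proof (cases "w = 0")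
    case False
    have "(norm (A *v ((1 / norm w) *\<^sub>R w)))\<^sup>2 \<le> \<mu>"
      unfolding \<mu>_def using False by (intro max) simp
    then show ?thesis
      using False by (simp add: matrix_vector_mult_scaleR power_divide divide_simps)
  qed simp
  have "(\<mu> *\<^sub>R u - (transpose A ** A) *v u) \<bullet> w = 0" for w
  proof -
    define p where "p = (\<mu> *\<^sub>R u - (transpose A ** A) *v u) \<bullet> w"
    define q where "q = \<mu> * (norm w)\<^sup>2 - (norm (A *v w))\<^sup>2"
    have nonneg: "0 \<le> 2 * t * p + t\<^sup>2 * q" for t
    proof -
      have "\<mu> * (norm (u + t *\<^sub>R w))\<^sup>2 - (norm (A *v (u + t *\<^sub>R w)))\<^sup>2 = 2 * t * p + t\<^sup>2 * q"
        using u inner_gram[of A u w]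
        by (simp add: p_def q_def \<mu>_def matrix_vector_right_distrib matrix_vector_mult_scaleR
            power2_norm_add_scaleR inner_diff_left algebra_simps)
      then show ?thesis using bound[of "u + t *\<^sub>R w"] by linarith
    qed
    have "q \<ge> 0" using bound[of w] by (simp add: q_def)
    \<comment> \<open>At \<open>t = - e\<close> the form is \<open>- (e\<^sup>2 * (q + 2))\<close>,
      so its nonnegativity forces \<open>e = 0\<close>. The summand 1 keeps the denominator positive
      when \<open>q = 0\<close>.\<close>
    define e where "e = p / (q + 1)"
    have p: "p = e * (q + 1)" using \<open>q \<ge> 0\<close> by (simp add: e_def)
    have "0 \<le> 2 * (- e) * p + (- e)\<^sup>2 * q" by (rule nonneg)
    also have "\<dots> = - (e\<^sup>2 * (q + 2))" by (simp add: p power2_eq_square algebra_simps)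
    finally have "e = 0" using \<open>q \<ge> 0\<close> by (simp add: mult_le_0_iff)
    then show ?thesis using p by (simp add: p_def)
  qed
  then have "(transpose A ** A) *v u = \<mu> *\<^sub>R u"
    by (metis inner_eq_zero_iff right_minus_eq)
  then have "\<mu> \<le> lambda_max (transpose A ** A)"
    unfolding lambda_max_def using u by (intro Max_ge finite_eigenvalues_gram) (auto intro!: exI[of _ u])
  then show ?thesis
    using bound[of v] by (meson mult_right_mono order_trans zero_le_power2)
qed

section \<open>Gradient and second-order expansion of the objective\<close>

lemma gradientI:
  assumes "GDERIV f x :> g"
  shows "gradient f x = g"
proof -
  have "h = g" if "GDERIV f x :> h" for h
    using has_derivative_unique[OF that[unfolded gderiv_def] assms[unfolded gderiv_def]]
    by (metis inner_commute inner_diff_left inner_eq_zero_iff right_minus_eq)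
  with assms show ?thesis unfolding gradient_def by (intro the_equality)
qed

lemma gradient_objective:
  "gradient (objective A b) x = transpose A *v (A *v x - b)"
proof (rule gradientI)
  have eq: "objective A b = (\<lambda>x. 1 / 2 * ((A *v x - b) \<bullet> (A *v x - b)))"
    by (simp add: fun_eq_iff objective_def power2_norm_eq_inner)
  show "GDERIV (objective A b) x :> transpose A *v (A *v x - b)"
    unfolding gderiv_def eq
    by (rule has_derivative_eq_rhs,
        (rule derivative_intros bounded_linear.has_derivative[OF matrix_vector_mul_bounded_linear])+)
      (simp add: fun_eq_iff inner_commute flip: dot_lmul_matrix transpose_matrix_vector)
qed

text \<open>The objective is quadratic, so its second-order Taylor formula is exact. Dropping the
  last term gives convexity; bounding it by the largest eigenvalue gives the descent
  inequality.\<close>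

lemma objective_expansion:
  "objective A b y = objective A b x + gradient (objective A b) x \<bullet> (y - x)
     + 1 / 2 * (norm (A *v (y - x)))\<^sup>2"
proof -
  have "gradient (objective A b) x \<bullet> (y - x) = (A *v x - b) \<bullet> (A *v (y - x))"
    by (simp add: gradient_objective flip: dot_lmul_matrix transpose_matrix_vector)
  moreover have "A *v y - b = (A *v x - b) + A *v (y - x)"
    by (simp add: matrix_vector_mult_diff_distrib)
  ultimately show ?thesis
    unfolding objective_def by (simp add: power2_norm_eq_inner inner_simps inner_commute)
qed

lemma objective_ge_tangent:
  "objective A b x + gradient (objective A b) x \<bullet> (y - x) \<le> objective A b y"
  using objective_expansion[of A b y x] by simp

lemma objective_descent:
  "objective A b y \<le> objective A b x + gradient (objective A b) x \<bullet> (y - x)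
     + lambda_max (transpose A ** A) / 2 * (norm (y - x))\<^sup>2"
  using objective_expansion[of A b y x] norm_matrix_vector_le_lambda_max[of A "y - x"] by simp

lemma isCont_gradient_objective: "isCont (gradient (objective A b)) x"
proof -
  have "gradient (objective A b) = (\<lambda>x. transpose A *v (A *v x - b))"
    by (simp add: fun_eq_iff gradient_objective)
  moreover have "isCont (\<lambda>x. transpose A *v (A *v x - b)) x"
    by (intro continuous_intros bounded_linear.isCont[OF matrix_vector_mul_bounded_linear])
  ultimately show ?thesis by simp
qed

section \<open>Projection onto the sparse nonnegative vectors\<close>

lemma mem_feasible_iff: "y \<in> feasible s \<longleftrightarrow> card (supp y) \<le> s \<and> (\<forall>i. 0 \<le> y $ i)"
  by (auto simp: feasible_def sparse_set_def nonneg_orthant_def l0norm_def)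

lemma feasible_mono:
  assumes "y \<in> feasible s" "supp w \<subseteq> supp y" "\<And>i. 0 \<le> w $ i"
  shows "w \<in> feasible s"
  using assms card_mono[of "supp y" "supp w"] by (simp add: mem_feasible_iff)

lemma proj_set_iff:
  "y \<in> proj_set C u \<longleftrightarrow> y \<in> C \<and> (\<forall>w\<in>C. norm (u - y) \<le> norm (u - w))"
  by (auto simp: proj_set_def is_arg_min_linorder)

lemma power2_norm_vec: "(norm (v :: real ^ 'n))\<^sup>2 = (\<Sum>i\<in>UNIV. (v $ i)\<^sup>2)"
  unfolding power2_norm_eq_inner inner_vec_def by (simp add: power2_eq_square)

text \<open>Coordinates outside \<open>J\<close> contribute equally to both distances and cancel.
  The next three lemmas apply this to competitors altered in one or two coordinates.\<close>

lemma proj_set_compare: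
  fixes u y w :: "real ^ 'n"
  assumes "y \<in> proj_set C u" "w \<in> C" "\<And>i. i \<notin> J \<Longrightarrow> w $ i = y $ i"
  shows "(\<Sum>i\<in>J. (u $ i - y $ i)\<^sup>2) \<le> (\<Sum>i\<in>J. (u $ i - w $ i)\<^sup>2)"
proof -
  have "(norm (u - y))\<^sup>2 \<le> (norm (u - w))\<^sup>2"
    using assms(1,2) by (simp add: proj_set_iff power_mono)
  moreover have split: "(norm v)\<^sup>2 = (\<Sum>i\<in>J. (v $ i)\<^sup>2) + (\<Sum>i\<in>-J. (v $ i)\<^sup>2)" for v :: "real ^ 'n"
    unfolding power2_norm_vec
    by (simp add: sum.union_disjoint[symmetric])
  moreover have "(\<Sum>i\<in>-J. ((u - y) $ i)\<^sup>2) = (\<Sum>i\<in>-J. ((u - w) $ i)\<^sup>2)"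
    using assms(3) by (intro sum.cong) auto
  ultimately show ?thesis by (simp add: split[of "u - y"] split[of "u - w"])
qed

lemma proj_feasible_eq:
  assumes "y \<in> proj_set (feasible s) u" "i \<in> supp y"
  shows "y $ i = u $ i"
proof -
  have y: "y \<in> feasible s" using assms(1) by (simp add: proj_set_iff)
  then have pos: "0 < y $ i" using assms(2) by (auto simp: mem_feasible_iff supp_def order_less_le)
  \<comment> \<open>The best admissible value at \<open>i\<close>. If \<open>u $ i\<close> is not
    positive, this value is 0 and strictly beats the positive \<open>y $ i\<close>; otherwise it is
    \<open>u $ i\<close> itself.\<close>
  define w where "w = (\<chi> k. if k = i then max (u $ i) 0 else y $ k)"
  have "w \<in> feasible s"
    by (rule feasible_mono[OF y]) (use assms(2) y in \<open>auto simp: w_def supp_def mem_feasible_iff\<close>)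
  from proj_set_compare[OF assms(1) this, of "{i}"]
  have le: "(u $ i - y $ i)\<^sup>2 \<le> (u $ i - max (u $ i) 0)\<^sup>2" by (simp add: w_def)
  show ?thesis
  proof (cases "0 < u $ i")
    case True
    with le show ?thesis by simp
  next
    case False
    then have "(u $ i)\<^sup>2 < (u $ i - y $ i)\<^sup>2"
      using pos by (simp add: power2_eq_square mult_strict_mono' algebra_simps add_pos_nonneg mult_le_0_iff add_nonneg_pos)
    with le False show ?thesis by (simp add: max_def)
  qed
qed

text \<open>If there were room for one more nonzero entry, setting coordinate \<open>j\<close> to
  \<open>u $ j\<close> would bring the point closer to \<open>u\<close>.\<close>

lemma proj_feasible_saturated:
  assumes "y \<in> proj_set (feasible s) u" "j \<notin> supp y" "0 < u $ j"
  shows "card (supp y) = s"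
proof (rule ccontr)
  assume neq: "card (supp y) \<noteq> s"
  have y: "y \<in> feasible s" using assms(1) by (simp add: proj_set_iff)
  define w where "w = (\<chi> k. if k = j then u $ j else y $ k)"
  have "supp w \<subseteq> insert j (supp y)" by (auto simp: w_def supp_def)
  then have "card (supp w) \<le> card (insert j (supp y))" by (intro card_mono) auto
  with neq y assms(2,3) have "w \<in> feasible s" by (auto simp: mem_feasible_iff w_def)
  from proj_set_compare[OF assms(1) this, of "{j}"] assms(2,3) show False
    by (simp add: w_def supp_def)
qed

text \<open>Exchange argument: giving up \<open>i\<close> in favour of \<open>j\<close> costs
  \<open>(y $ i)\<^sup>2\<close>, because \<open>y\<close> agrees with \<open>u\<close> at
  \<open>i\<close>, and saves \<open>(u $ j)\<^sup>2\<close>.\<close>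

lemma proj_feasible_ge:
  assumes "y \<in> proj_set (feasible s) u" "j \<notin> supp y" "0 < u $ j" "i \<in> supp y"
  shows "u $ j \<le> y $ i"
proof -
  have y: "y \<in> feasible s" using assms(1) by (simp add: proj_set_iff)
  have ij: "i \<noteq> j" using assms(2,4) by auto
  define w where "w = (\<chi> k. if k = j then u $ j else if k = i then 0 else y $ k)"
  have "supp w \<subseteq> insert j (supp y - {i})" by (auto simp: w_def supp_def)
  then have "card (supp w) \<le> card (insert j (supp y - {i}))" by (intro card_mono) auto
  also have "\<dots> = card (supp y)"
    using assms(2,4) by (metis DiffD1 card.insert_remove card_Suc_Diff1 card_insert_disjoint finite)
  finally have "w \<in> feasible s" using y assms(3) by (auto simp: mem_feasible_iff w_def)
  from proj_set_compare[OF assms(1) this, of "{i,j}"] ij assms(2)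
  have "(u $ j)\<^sup>2 \<le> (y $ i)\<^sup>2"
    by (simp add: w_def supp_def proj_feasible_eq[OF assms(1,4)])
  then show ?thesis using y by (simp add: mem_feasible_iff power2_le_iff_abs_le)
qed

text \<open>The competitor is \<open>x\<close> itself; the term
  \<open>t\<^sup>2 * (norm g)\<^sup>2\<close> occurs in both squared distances and cancels.\<close>

lemma proj_gradient_step_decrease:
  fixes x g :: "'a :: real_inner"
  assumes "x \<in> C" "y \<in> proj_set C (x - t *\<^sub>R g)" "0 < t"
  shows "g \<bullet> (y - x) \<le> - (norm (y - x))\<^sup>2 / (2 * t)"
proof -
  have "(norm ((x - t *\<^sub>R g) - y))\<^sup>2 \<le> (norm ((x - t *\<^sub>R g) - x))\<^sup>2"
    using assms(1,2) unfolding proj_set_iff by (intro power_mono) auto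
  moreover have "(norm ((x - t *\<^sub>R g) - y))\<^sup>2 =
      (norm (y - x))\<^sup>2 + 2 * t * (g \<bullet> (y - x)) + t\<^sup>2 * (norm g)\<^sup>2"
    unfolding power2_norm_eq_inner
    by (simp add: algebra_simps inner_simps inner_commute power2_eq_square)
  ultimately have "(norm (y - x))\<^sup>2 + 2 * t * (g \<bullet> (y - x)) \<le> 0"
    by (simp add: power_mult_distrib)
  then show ?thesis using assms(3) by (simp add: field_simps)
qed

text \<open>Expanding squares reduces stationarity to \<open>0 \<le> (norm (w - z))\<^sup>2 + 2 * a
  * (g \<bullet> (w - z))\<close> for feasible \<open>w\<close>. For a nonnegative gradient the
  linear term is nonnegative and \<open>a = 1\<close> works. Otherwise the support is full, so a new
  coordinate must displace an old one, and a small \<open>a\<close> works.\<close>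

lemma stationary_feasible:
  fixes z :: "real ^ 'n"
  assumes z: "z \<in> feasible s" and "0 < s"
    and zero: "\<And>i. i \<in> supp z \<Longrightarrow> gradient f z $ i = 0"
    and sign: "card (supp z) = s \<or> (\<forall>i. 0 \<le> gradient f z $ i)"
  shows "\<exists>a>0. stationary (feasible s) f a z"
proof -
  define g where "g = gradient f z"
  have inner: "g \<bullet> (w - z) = (\<Sum>i\<in>-supp z. g $ i * w $ i)" for w
  proof -
    have "g \<bullet> (w - z) = (\<Sum>i\<in>UNIV. g $ i * (w $ i - z $ i))" by (simp add: inner_vec_def)
    also have "\<dots> = (\<Sum>i\<in>-supp z. g $ i * (w $ i - z $ i))"
      using zero by (intro sum.mono_neutral_right) (auto simp: g_def)
    also have "\<dots> = (\<Sum>i\<in>-supp z. g $ i * w $ i)"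
      by (intro sum.cong) (auto simp: supp_def)
    finally show ?thesis .
  qed
  have suff: "stationary (feasible s) f a z"
    if *: "\<And>w. w \<in> feasible s \<Longrightarrow> 0 \<le> (norm (w - z))\<^sup>2 + 2 * a * (g \<bullet> (w - z))" for a
  proof -
    have "norm (z - a *\<^sub>R g - z) \<le> norm (z - a *\<^sub>R g - w)" if "w \<in> feasible s" for w
    proof (rule power2_le_imp_le)
      have "(norm (z - a *\<^sub>R g - w))\<^sup>2
          = (norm (z - a *\<^sub>R g - z))\<^sup>2 + ((norm (w - z))\<^sup>2 + 2 * a * (g \<bullet> (w - z)))"
        unfolding power2_norm_eq_inner by (simp add: algebra_simps inner_simps inner_commute)
      with *[OF that] show "(norm (z - a *\<^sub>R g - z))\<^sup>2 \<le> (norm (z - a *\<^sub>R g - w))\<^sup>2" by linarith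
    qed simp
    then show ?thesis
      using z by (simp add: stationary_def proj_set_iff g_def)
  qed
  show ?thesis
  proof (cases "\<forall>i. 0 \<le> g $ i")
    case True
    have "0 \<le> g \<bullet> (w - z)" if "w \<in> feasible s" for w
      unfolding inner using True that by (intro sum_nonneg) (auto simp: mem_feasible_iff)
    then have "stationary (feasible s) f 1 z" by (intro suff) simp
    then show ?thesis by (intro exI[of _ 1]) simp
  next
    case False
    with sign have card: "card (supp z) = s" by (auto simp: g_def)
    \<comment> \<open>A competitor with new support elements loses at least as many old ones. Each loss costs \<open>m\<^sup>2\<close>,
      and each new element gains at most \<open>(a |g|)\<^sup>2\<close>, which \<open>a\<close> is chosen to keep below \<open>m\<^sup>2\<close>.\<close>
    define m where "m = Min ((\<lambda>i. z $ i) ` supp z)"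
    have ne: "supp z \<noteq> {}" using card \<open>0 < s\<close> by auto
    then have "m \<in> (\<lambda>i. z $ i) ` supp z" unfolding m_def by (intro Min_in) auto
    then have m_pos: "0 < m" using z by (auto simp: supp_def mem_feasible_iff order_less_le)
    have m_le: "m \<le> z $ i" if "i \<in> supp z" for i using that by (auto simp: m_def)
    define a where "a = m / (norm g + 1)"
    have a_pos: "0 < a" using m_pos by (simp add: a_def add_nonneg_pos)
    have "a * norm g \<le> a * (norm g + 1)" using a_pos by simp
    also have "\<dots> = m" using norm_ge_zero[of g] by (simp add: a_def add_nonneg_eq_0_iff)
    finally have ag: "a * norm g \<le> m" .
    have "0 \<le> (norm (w - z))\<^sup>2 + 2 * a * (g \<bullet> (w - z))" if w: "w \<in> feasible s" for w
    proof -
      have "card (supp w - supp z) \<le> card (supp z - supp w)"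
        using w card card_Diff_subset_Int[of "supp w" "supp z"] card_Diff_subset_Int[of "supp z" "supp w"]
        by (auto simp: mem_feasible_iff Int_commute intro: diff_le_mono)
      then have cnt: "real (card (supp w - supp z)) * m\<^sup>2 \<le> real (card (supp z - supp w)) * m\<^sup>2"
        by (intro mult_right_mono) auto
      have "real (card (supp z - supp w)) * m\<^sup>2 = (\<Sum>i\<in>supp z - supp w. m\<^sup>2)" by simp
      also have "\<dots> \<le> (\<Sum>i\<in>supp z - supp w. (w $ i - z $ i)\<^sup>2)"
        using m_le m_pos by (intro sum_mono) (auto simp: supp_def intro!: power_mono)
      also have "\<dots> \<le> (\<Sum>i\<in>supp z. (w $ i - z $ i)\<^sup>2)"
        by (intro sum_mono2) auto
      finally have on: "real (card (supp z - supp w)) * m\<^sup>2 \<le> (\<Sum>i\<in>supp z. (w $ i - z $ i)\<^sup>2)" .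
      \<comment> \<open>Complete the square: the right side is
        \<open>(w $ i + a * g $ i)\<^sup>2 - (a * g $ i)\<^sup>2\<close>.\<close>
      have entry: "- m\<^sup>2 \<le> (w $ i)\<^sup>2 + 2 * a * (g $ i * w $ i)" for i
      proof -
        have "\<bar>a * g $ i\<bar> \<le> m"
          using component_le_norm_cart[of g i] a_pos ag
          by (simp add: abs_mult) (meson mult_left_mono order.strict_implies_order order_trans)
        then have "(a * g $ i)\<^sup>2 \<le> m\<^sup>2" using m_pos by (simp flip: abs_le_square_iff)
        moreover have "0 \<le> (w $ i + a * g $ i)\<^sup>2" by simp
        ultimately show ?thesis by (simp add: power2_eq_square algebra_simps)
      qed
      have "- (real (card (supp w - supp z)) * m\<^sup>2) = (\<Sum>i\<in>supp w - supp z. - m\<^sup>2)"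
        by (simp add: sum_negf)
      also have "\<dots> \<le> (\<Sum>i\<in>supp w - supp z. (w $ i)\<^sup>2 + 2 * a * (g $ i * w $ i))"
        by (intro sum_mono entry)
      also have "\<dots> = (\<Sum>i\<in>-supp z. (w $ i)\<^sup>2 + 2 * a * (g $ i * w $ i))"
        by (intro sum.mono_neutral_left) (auto simp: supp_def)
      also have "\<dots> = (\<Sum>i\<in>-supp z. (w $ i - z $ i)\<^sup>2) + 2 * a * (g \<bullet> (w - z))"
        unfolding inner sum.distrib sum_distrib_left
        by (intro arg_cong2[where f = "(+)"] sum.cong) (auto simp: supp_def)
      finally have off: "- (real (card (supp w - supp z)) * m\<^sup>2)
          \<le> (\<Sum>i\<in>-supp z. (w $ i - z $ i)\<^sup>2) + 2 * a * (g \<bullet> (w - z))" .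
      have "(norm (w - z))\<^sup>2 = (\<Sum>i\<in>supp z. (w $ i - z $ i)\<^sup>2) + (\<Sum>i\<in>-supp z. (w $ i - z $ i)\<^sup>2)"
        unfolding power2_norm_vec by (simp add: sum.union_disjoint[symmetric])
      with cnt on off show ?thesis by linarith
    qed
    then show ?thesis using a_pos suff by blast
  qed
qed

section \<open>The Clarke tangent cone\<close>

text \<open>Supports are finite, so positivity of the limit coordinates passes to late terms
  simultaneously. Hence a support can shrink in the limit but not grow.\<close>

lemma eventually_pos_on_supp:
  fixes X :: "'b \<Rightarrow> real ^ 'n"
  assumes "(X \<longlongrightarrow> z) F" "\<And>i. 0 \<le> z $ i"
  shows "eventually (\<lambda>k. \<forall>i\<in>supp z. 0 < X k $ i) F"
proof -
  have "eventually (\<lambda>k. 0 < X k $ i) F" if "i \<in> supp z" for i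
    using that assms(2)[of i] by (intro order_tendstoD(1)[OF tendsto_vec_nth[OF assms(1)]])
      (auto simp: supp_def)
  then show ?thesis by (simp add: eventually_ball_finite_distrib)
qed

lemma closed_feasible: "closed (feasible s :: (real ^ 'n) set)"
  unfolding closed_sequential_limits
proof (intro allI impI, elim conjE)
  fix X :: "nat \<Rightarrow> real ^ 'n" and z
  assume X: "\<forall>n. X n \<in> feasible s" and lim: "X \<longlonglongrightarrow> z"
  have nonneg: "0 \<le> z $ i" for i
    using X by (intro LIMSEQ_le_const[OF tendsto_vec_nth[OF lim]]) (auto simp: mem_feasible_iff)
  from eventually_pos_on_supp[OF lim nonneg]
  obtain n where "\<forall>i\<in>supp z. 0 < X n $ i" using eventually_happens'[OF sequentially_bot] by blast
  then have "supp z \<subseteq> supp (X n)" by (auto simp: supp_def)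
  with X nonneg show "z \<in> feasible s" by (blast intro: feasible_mono)
qed

text \<open>Moving slightly along \<open>supp x\<close> keeps every nearby feasible point feasible.
  Conversely, when \<open>x $ j = 0\<close>, nearby points with \<open>s\<close> positive entries
  and a zero at \<open>j\<close> leave no room to move in direction \<open>j\<close>.\<close>

lemma clarke_tangent_cone_feasible:
  fixes x :: "real ^ 'n"
  assumes x: "x \<in> feasible s" and "s < CARD('n)"
  shows "clarke_tangent_cone (feasible s) x = {d. supp d \<subseteq> supp x}"
proof (intro equalityI subsetI)
  fix d assume d: "d \<in> {d. supp d \<subseteq> supp x}"
  show "d \<in> clarke_tangent_cone (feasible s) x"
    unfolding clarke_tangent_cone_def
  proof (intro CollectI allI impI, elim conjE)
    fix X :: "nat \<Rightarrow> real ^ 'n" and l :: "nat \<Rightarrow> real"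
    assume X: "\<forall>k. X k \<in> feasible s" "X \<longlonglongrightarrow> x" and l: "\<forall>k. 0 \<le> l k" "l \<longlonglongrightarrow> 0"
    \<comment> \<open>The definition asks for feasibility at every \<open>k\<close>; the default 0
      serves the finitely many early indices where \<open>d\<close> fails, since \<open>X k\<close>
      is feasible.\<close>
    define y where "y k = (if X k + l k *\<^sub>R d \<in> feasible s then d else 0)" for k
    have nonneg: "0 \<le> x $ i" for i using x by (simp add: mem_feasible_iff)
    have "(\<lambda>k. X k + l k *\<^sub>R d) \<longlonglongrightarrow> x + 0 *\<^sub>R d"
      by (intro tendsto_intros X l)
    then have "eventually (\<lambda>k. \<forall>i\<in>supp x. 0 < (X k + l k *\<^sub>R d) $ i) sequentially"
      using nonneg by (intro eventually_pos_on_supp) auto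
    moreover have "eventually (\<lambda>k. \<forall>i\<in>supp x. 0 < X k $ i) sequentially"
      by (rule eventually_pos_on_supp[OF X(2) nonneg])
    ultimately have "eventually (\<lambda>k. X k + l k *\<^sub>R d \<in> feasible s) sequentially"
    proof eventually_elim
      case (elim k)
      have off: "i \<notin> supp x \<Longrightarrow> d $ i = 0" for i using d by (auto simp: supp_def)
      have "supp (X k + l k *\<^sub>R d) \<subseteq> supp (X k)"
        using elim off by (fastforce simp: supp_def)
      moreover have "0 \<le> (X k + l k *\<^sub>R d) $ i" for i
        using elim(1) off[of i] X(1) by (cases "i \<in> supp x") (auto simp: mem_feasible_iff less_imp_le)
      ultimately show ?case using X(1) feasible_mono by blast
    qed
    then have "eventually (\<lambda>k. d = y k) sequentially"
      by eventually_elim (simp add: y_def)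
    then have "y \<longlonglongrightarrow> d"
      by (rule Lim_transform_eventually[rotated]) simp
    moreover have "\<forall>k. X k + l k *\<^sub>R y k \<in> feasible s" using X by (simp add: y_def)
    ultimately show "\<exists>y. y \<longlonglongrightarrow> d \<and> (\<forall>k. X k + l k *\<^sub>R y k \<in> feasible s)" by blast
  qed
next
  fix d assume d: "d \<in> clarke_tangent_cone (feasible s) x"
  have "d $ j = 0" if j: "x $ j = 0" for j
  proof -
    \<comment> \<open>Here \<open>s < CARD('n)\<close> enters: \<open>s\<close> indices can be found
      while avoiding \<open>j\<close>.\<close>
    have "\<exists>\<Gamma>. supp x \<subseteq> \<Gamma> \<and> \<Gamma> \<subseteq> UNIV - {j} \<and> card \<Gamma> = s"
      using x j assms(2) by (intro exists_subset_between) (auto simp: supp_def mem_feasible_iff)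
    then obtain \<Gamma> where \<Gamma>: "supp x \<subseteq> \<Gamma>" "j \<notin> \<Gamma>" "card \<Gamma> = s" by blast
    \<comment> \<open>Approach \<open>x\<close> with the full support \<open>\<Gamma>\<close>, by perturbations that dominate the step sizes,
      so that the moved points have support exactly \<open>\<Gamma>\<close>.\<close>
    define e where "e k = inverse (real (Suc k))" for k
    have e: "e \<longlonglongrightarrow> 0" "0 < e k" for k
      using LIMSEQ_inverse_real_of_nat by (simp_all add: e_def[abs_def])
    define X where "X k = x + e k *\<^sub>R (\<chi> i. if i \<in> \<Gamma> then 1 else 0)" for k
    have "X \<longlonglongrightarrow> x + 0 *\<^sub>R (\<chi> i. if i \<in> \<Gamma> then 1 else 0)"
      unfolding X_def by (intro tendsto_intros e)
    then have Xlim: "X \<longlonglongrightarrow> x" by simp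
    have X_ge: "(if i \<in> \<Gamma> then e k else 0) \<le> X k $ i" for k i
      using x by (auto simp: X_def mem_feasible_iff)
    have X_off: "X k $ i = 0" if "i \<notin> \<Gamma>" for k i
      using that \<Gamma>(1) by (auto simp: X_def supp_def)
    have Xf: "X k \<in> feasible s" for k
    proof -
      have "supp (X k) \<subseteq> \<Gamma>" using X_off by (auto simp: supp_def)
      then have "card (supp (X k)) \<le> s" using card_mono[of \<Gamma> "supp (X k)"] \<Gamma>(3) by simp
      moreover have "0 \<le> X k $ i" for i using X_ge[of i k] e(2)[of k] by (auto split: if_splits)
      ultimately show ?thesis by (simp add: mem_feasible_iff)
    qed
    have sq: "(\<lambda>k. (e k)\<^sup>2) \<longlonglongrightarrow> 0" using tendsto_power[OF e(1), of 2] by simp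
    obtain y where y: "y \<longlonglongrightarrow> d" "\<And>k. X k + (e k)\<^sup>2 *\<^sub>R y k \<in> feasible s"
      using CollectD[OF d[unfolded clarke_tangent_cone_def], rule_format, of X "\<lambda>k. (e k)\<^sup>2"] Xf Xlim sq
      by auto
    have "eventually (\<lambda>k. - 1 < e k * y k $ i) sequentially" for i
      by (rule order_tendstoD(1)[OF tendsto_mult[OF e(1) tendsto_vec_nth[OF y(1)]]]) simp
    then have "eventually (\<lambda>k. \<forall>i. - 1 < e k * y k $ i) sequentially"
      by (simp add: eventually_all_finite)
    then have "eventually (\<lambda>k. y k $ j = 0) sequentially"
    proof eventually_elim
      case (elim k)
      have "0 < (X k + (e k)\<^sup>2 *\<^sub>R y k) $ i" if "i \<in> \<Gamma>" for i
      proof -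
        have "0 < e k * (1 + e k * y k $ i)" using e(2) elim[rule_format, of i] by simp
        then show ?thesis using X_ge[of i k] that by (simp add: power2_eq_square algebra_simps)
      qed
      then have "\<Gamma> \<subseteq> supp (X k + (e k)\<^sup>2 *\<^sub>R y k)" by (fastforce simp: supp_def)
      then have "\<Gamma> = supp (X k + (e k)\<^sup>2 *\<^sub>R y k)"
        using y(2)[of k] \<Gamma>(3) by (intro card_seteq) (auto simp: mem_feasible_iff)
      then have "(X k + (e k)\<^sup>2 *\<^sub>R y k) $ j = 0" using \<Gamma>(2) by (auto simp: supp_def)
      then show ?case using X_off[OF \<Gamma>(2)] e(2)[of k] by simp
    qed
    then have "(\<lambda>k. y k $ j) \<longlonglongrightarrow> 0" by (rule tendsto_eventually)
    with tendsto_vec_nth[OF y(1)] show ?thesis by (rule LIMSEQ_unique)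
  qed
  then show "d \<in> {d. supp d \<subseteq> supp x}" by (auto simp: supp_def)
qed

text \<open>The cone is a coordinate subspace, so the minimizer is the orthogonal projection of the
  negative gradient. The Pythagorean identity \<open>split\<close> gives minimality and also
  uniqueness, which fixes the choice made by \<open>arg_min_on\<close>.\<close>

lemma clarke_gradient_feasible:
  fixes x :: "real ^ 'n"
  assumes x: "x \<in> feasible s" and "s < CARD('n)"
  shows "clarke_gradient (feasible s) f x = (\<chi> i. if i \<in> supp x then - gradient f x $ i else 0)"
proof -
  define g where "g = gradient f x"
  define h :: "real ^ 'n" where "h = (\<chi> i. if i \<in> supp x then - g $ i else 0)"
  have split: "(norm (d + g))\<^sup>2 = (norm (d - h))\<^sup>2 + (norm (h + g))\<^sup>2" if "supp d \<subseteq> supp x" for d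
    unfolding power2_norm_vec sum.distrib[symmetric]
    
  proof (intro sum.cong refl)
    fix i
    show "((d + g) $ i)\<^sup>2 = ((d - h) $ i)\<^sup>2 + ((h + g) $ i)\<^sup>2"
      using in_mono[OF that, of i]
      by (cases "i \<in> supp x") (auto simp: h_def supp_def[of d])
  qed
  have cone: "clarke_tangent_cone (feasible s) x = {d. supp d \<subseteq> supp x}"
    by (rule clarke_tangent_cone_feasible[OF assms])
  have h: "supp h \<subseteq> supp x" by (auto simp: h_def supp_def)
  have "norm (h + g) \<le> norm (d + g)" if "supp d \<subseteq> supp x" for d
  proof (rule power2_le_imp_le)
    show "(norm (h + g))\<^sup>2 \<le> (norm (d + g))\<^sup>2"
      using split[OF that] zero_le_power2[of "norm (d - h)"] by linarith
  qed simp
  then have min: "is_arg_min (\<lambda>d. norm (d + g)) (\<lambda>d. d \<in> clarke_tangent_cone (feasible s) x) h"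
    using h by (simp add: is_arg_min_linorder cone)
  have uniq: "d = h"
    if "is_arg_min (\<lambda>d. norm (d + g)) (\<lambda>d. d \<in> clarke_tangent_cone (feasible s) x) d" for d
  proof -
    have "supp d \<subseteq> supp x" "norm (d + g) \<le> norm (h + g)"
      using that h by (auto simp: is_arg_min_linorder cone)
    then have "(norm (d - h))\<^sup>2 \<le> 0"
      using split[of d] power_mono[of "norm (d + g)" "norm (h + g)" 2] norm_ge_zero[of "d + g"]
      by linarith
    then show ?thesis by simp
  qed
  show ?thesis
    unfolding clarke_gradient_def arg_min_on_def arg_min_def g_def[symmetric] h_def[symmetric]
    by (intro some_equality min uniq)
qed

section \<open>Convergence\<close>

text \<open>A run seen as projected gradient steps, each of which either has the full stepsize
  \<open>a0\<close> or passed the line search test.\<close>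

locale gspa_steps =
  fixes A :: "real ^ 'n ^ 'm" and b :: "real ^ 'm" and s :: nat
    and a0 \<sigma> :: real and x :: "nat \<Rightarrow> real ^ 'n" and \<alpha> :: "nat \<Rightarrow> real"
    and r :: "real ^ 'n \<Rightarrow> real" and g :: "real ^ 'n \<Rightarrow> real ^ 'n"
  assumes r_eq: "r = objective A b" and g_eq: "g = gradient (objective A b)"
    and a0: "0 < a0" "a0 * lambda_max (transpose A ** A) < 1"
    and \<sigma>: "0 < \<sigma>"
    and feas: "x n \<in> feasible s"
    and step: "x (Suc n) \<in> proj_set (feasible s) (x n - \<alpha> n *\<^sub>R g (x n))"
    and \<alpha>: "0 < \<alpha> n" "\<alpha> n \<le> a0"
    and accepted: "\<alpha> n = a0 \<or> sufficient_decrease r \<sigma> (x n) (\<alpha> n) (x (Suc n))"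
begin

definition D where "D n = (1 / \<alpha> n) *\<^sub>R (x (Suc n) - x n)"

lemma increment: "x (Suc n) - x n = \<alpha> n *\<^sub>R D n"
  using \<alpha>(1)[of n] by (simp add: D_def)

text \<open>The smaller of two rates of decrease: the one demanded by the line search and the one
  that a full step guarantees.\<close>

definition c where "c = min (\<sigma> / 2) (a0 * (1 - a0 * lambda_max (transpose A ** A)) / 2)"

lemma c_pos: "0 < c"
  using a0 \<sigma> by (simp add: c_def)

text \<open>For a full step, the projection inequality is combined with the descent inequality; for
  a line search step, the acceptance test is already the bound.\<close>

lemma decrease: "r (x (Suc n)) + c * (norm (D n))\<^sup>2 \<le> r (x n)"
  using accepted[of n]
proof
  assume eq: "\<alpha> n = a0"
  define N where "N = (norm (D n))\<^sup>2"
  define L where "L = lambda_max (transpose A ** A)"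
  have nrm: "(norm (x (Suc n) - x n))\<^sup>2 = a0\<^sup>2 * N"
    by (simp add: increment N_def eq power_mult_distrib)
  have "g (x n) \<bullet> (x (Suc n) - x n) \<le> - (a0\<^sup>2 * N) / (2 * a0)"
    using proj_gradient_step_decrease[OF feas step \<alpha>(1), of n] by (simp only: nrm eq)
  then have "r (x (Suc n)) \<le> r (x n) - (a0\<^sup>2 * N) / (2 * a0) + L / 2 * (a0\<^sup>2 * N)"
    using objective_descent[of A b "x (Suc n)" "x n"] nrm by (simp add: r_eq g_eq L_def)
  also have "\<dots> = r (x n) - a0 * (1 - a0 * L) / 2 * N"
    using a0 by (simp add: field_simps power2_eq_square)
  finally have "r (x (Suc n)) + a0 * (1 - a0 * L) / 2 * N \<le> r (x n)" by simp
  moreover have "c * N \<le> a0 * (1 - a0 * L) / 2 * N"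
    by (intro mult_right_mono) (simp_all add: c_def L_def N_def)
  ultimately show ?thesis by (simp add: N_def)
next
  assume "sufficient_decrease r \<sigma> (x n) (\<alpha> n) (x (Suc n))"
  then have "r (x (Suc n)) + \<sigma> / 2 * (norm (D n))\<^sup>2 \<le> r (x n)"
    using \<alpha>(1)[of n]
    by (simp add: sufficient_decrease_def increment power_mult_distrib)
  moreover have "c * (norm (D n))\<^sup>2 \<le> \<sigma> / 2 * (norm (D n))\<^sup>2"
    by (intro mult_right_mono) (simp_all add: c_def)
  ultimately show ?thesis by linarith
qed

lemma decseq_r: "decseq (\<lambda>n. r (x n))"
proof (rule decseq_SucI)
  fix n
  have "0 \<le> c * (norm (D n))\<^sup>2" using c_pos by simp
  then show "r (x (Suc n)) \<le> r (x n)" using decrease[of n] by linarith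
qed

text \<open>The objective values decrease and are nonnegative, so they converge and their successive
  differences, which dominate \<open>c * (norm (D n))\<^sup>2\<close>, vanish.\<close>

lemma D_tendsto_0: "D \<longlonglongrightarrow> 0"
proof -
  have "0 \<le> r (x n)" for n by (simp add: r_eq objective_def)
  then obtain l where l: "(\<lambda>n. r (x n)) \<longlonglongrightarrow> l"
    using decseq_convergent[OF decseq_r] by blast
  then have "(\<lambda>n. (r (x n) - r (x (Suc n))) / c) \<longlonglongrightarrow> (l - l) / c"
    using c_pos by (intro tendsto_intros LIMSEQ_Suc) auto
  then have "(\<lambda>n. (r (x n) - r (x (Suc n))) / c) \<longlonglongrightarrow> 0" by simp
  moreover have "(norm (D n))\<^sup>2 \<le> (r (x n) - r (x (Suc n))) / c" for n
    using decrease[of n] c_pos by (simp add: field_simps)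
  ultimately have "(\<lambda>n. (norm (D n))\<^sup>2) \<longlonglongrightarrow> 0"
    by (intro tendsto_sandwich[of "\<lambda>_. 0" "\<lambda>n. (norm (D n))\<^sup>2" _ "\<lambda>n. (r (x n) - r (x (Suc n))) / c"]) auto
  then have "(\<lambda>n. sqrt ((norm (D n))\<^sup>2)) \<longlonglongrightarrow> sqrt 0" by (rule tendsto_real_sqrt)
  then show ?thesis by (simp add: tendsto_norm_zero_iff)
qed

lemma increment_tendsto_0: "(\<lambda>n. x (Suc n) - x n) \<longlonglongrightarrow> 0"
proof (rule Lim_null_comparison)
  show "\<forall>\<^sub>F n in sequentially. norm (x (Suc n) - x n) \<le> a0 * norm (D n)"
    using \<alpha> by (auto simp: increment less_imp_le abs_of_pos intro!: always_eventually mult_right_mono)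
  show "(\<lambda>n. a0 * norm (D n)) \<longlonglongrightarrow> 0"
    using tendsto_mult[OF tendsto_const tendsto_norm_zero[OF D_tendsto_0]] by simp
qed

lemma gradient_on_supp:
  assumes "i \<in> supp (x (Suc n))"
  shows "g (x n) $ i = - D n $ i"
proof -
  have "x (Suc n) $ i = (x n - \<alpha> n *\<^sub>R g (x n)) $ i"
    by (rule proj_feasible_eq[OF step assms])
  moreover have "x (Suc n) $ i - x n $ i = \<alpha> n * D n $ i"
    using arg_cong[OF increment[of n], of "\<lambda>v. v $ i"] by simp
  ultimately have "\<alpha> n * (g (x n) $ i + D n $ i) = 0" by (simp add: algebra_simps)
  then show ?thesis using \<alpha>(1)[of n] by simp
qed

lemma clarke_gradient_tendsto_0:
  assumes "s < CARD('n)"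
  shows "(\<lambda>n. norm (clarke_gradient (feasible s) (objective A b) (x n))) \<longlonglongrightarrow> 0"
\<comment> \<open>The index is shifted because \<open>D n\<close> gives the gradient at
  \<open>x n\<close> on the support of \<open>x (Suc n)\<close>. The change of gradient
  \<open>B n\<close> between the two points vanishes with the increment.\<close>
proof (rule LIMSEQ_imp_Suc, rule tendsto_norm_zero, rule vec_tendstoI)
  fix i
  define B where "B n = (transpose A ** A) *v (x (Suc n) - x n)" for n
  have g_Suc: "g (x (Suc n)) = g (x n) + B n" for n
    by (simp add: g_eq gradient_objective B_def matrix_vector_mul_assoc[symmetric]
        matrix_vector_mult_diff_distrib)
  have "B \<longlonglongrightarrow> (transpose A ** A) *v 0" unfolding B_def
    by (intro bounded_linear.tendsto[OF matrix_vector_mul_bounded_linear] increment_tendsto_0)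
  then have "(\<lambda>n. norm (D n) + norm (B n)) \<longlonglongrightarrow> 0"
    using tendsto_add[OF tendsto_norm_zero[OF D_tendsto_0] tendsto_norm_zero[of B]] by simp
  moreover have "norm (clarke_gradient (feasible s) (objective A b) (x (Suc n)) $ i)
      \<le> norm (D n) + norm (B n)" for n
  proof (cases "i \<in> supp (x (Suc n))")
    case True
    have "\<bar>g (x (Suc n)) $ i\<bar> \<le> \<bar>D n $ i\<bar> + \<bar>B n $ i\<bar>"
      by (simp add: g_Suc gradient_on_supp[OF True])
    also have "\<dots> \<le> norm (D n) + norm (B n)" by (intro add_mono component_le_norm_cart)
    finally show ?thesis using True by (simp add: clarke_gradient_feasible[OF feas assms] g_eq)
  qed (simp add: clarke_gradient_feasible[OF feas assms])
  ultimately show "(\<lambda>n. clarke_gradient (feasible s) (objective A b) (x (Suc n)) $ i) \<longlonglongrightarrow> 0 $ i"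
    by (simp only: zero_index) (rule Lim_null_comparison[OF always_eventually], auto)
qed

section \<open>Rigidity of iterates with a fixed support\<close>

text \<open>With unchanged support, \<open>g (x n) \<bullet> D n\<close> equals
  \<open>- (norm (D n))\<^sup>2\<close>, so by convexity \<open>r\<close> drops by at most
  \<open>\<alpha> n * (norm (D n))\<^sup>2\<close>. As \<open>\<alpha> n < a0\<close>, the line
  search test holds and demands a drop of
  \<open>\<sigma> / 2 * (norm (D n))\<^sup>2\<close>.\<close>

lemma short_step_same_supp:
  assumes "\<alpha> n < a0" "\<alpha> n < \<sigma> / 2" "supp (x (Suc n)) = supp (x n)"
  shows "x (Suc n) = x n"
proof -
  have off: "D n $ i = 0" if "i \<notin> supp (x n)" for i
    using that assms(3) by (auto simp: D_def supp_def)
  have "g (x n) \<bullet> D n = - (norm (D n))\<^sup>2"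
    unfolding inner_vec_def power2_norm_vec sum_negf[symmetric]
  proof (intro sum.cong refl)
    fix i show "g (x n) $ i \<bullet> D n $ i = - (D n $ i)\<^sup>2"
      using gradient_on_supp[of i n] off[of i] assms(3)
      by (cases "i \<in> supp (x n)") (auto simp: power2_eq_square)
  qed
  then have "r (x n) - \<alpha> n * (norm (D n))\<^sup>2 \<le> r (x (Suc n))"
    using objective_ge_tangent[of A b "x n" "x (Suc n)"] by (simp add: r_eq g_eq increment)
  moreover have "r (x (Suc n)) \<le> r (x n) - \<sigma> / 2 * (norm (D n))\<^sup>2"
    using accepted[of n] assms(1) \<alpha>(1)[of n]
    by (simp add: sufficient_decrease_def increment power_mult_distrib)
  ultimately have "(\<sigma> / 2 - \<alpha> n) * (norm (D n))\<^sup>2 \<le> 0" by (simp add: algebra_simps)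
  then have "D n = 0" using assms(2) by (simp add: mult_le_0_iff)
  then show ?thesis using increment[of n] by simp
qed

text \<open>Without loss of objective value from \<open>n\<close> to \<open>n'\<close>,
  \<open>decrease\<close> forces every intermediate \<open>D k\<close> to be 0.\<close>

lemma constant_between:
  assumes "n \<le> n'" "r (x n) \<le> r (x n')"
  shows "x n' = x n"
  using assms
proof (induction rule: dec_induct)
  case (step k)
  have "r (x (Suc k)) \<le> r (x k)" "r (x k) \<le> r (x n)"
    using decseq_r step.hyps by (auto simp: decseq_def)
  moreover have "0 \<le> c * (norm (D k))\<^sup>2" using c_pos by simp
  ultimately have "r (x n) \<le> r (x k)" "c * (norm (D k))\<^sup>2 \<le> 0"
    using decrease[of k] step.prems by linarith+
  then have "x k = x n" "D k = 0" using step.IH c_pos by (auto simp: mult_le_0_iff)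
  then show ?case using increment[of k] by simp
qed simp

text \<open>By convexity both points minimize \<open>r\<close> over vectors with their common
  support, so their values agree. Minimizers may be non-unique; equality of the points comes from
  \<open>constant_between\<close>.\<close>

lemma critical_on_same_supp:
  assumes "\<And>i. i \<in> supp (x n) \<Longrightarrow> g (x n) $ i = 0" "\<And>i. i \<in> supp (x n') \<Longrightarrow> g (x n') $ i = 0"
    and "supp (x n) = supp (x n')"
  shows "x n = x n'"
proof -
  have *: "r (x k) \<le> r (x l)"
    if "\<And>i. i \<in> supp (x k) \<Longrightarrow> g (x k) $ i = 0" "supp (x k) = supp (x l)" for k l
  proof -
    have "g (x k) $ i * (x l - x k) $ i = 0" for i
      using that by (cases "i \<in> supp (x k)") (auto simp: supp_def)
    then have "g (x k) \<bullet> (x l - x k) = 0" unfolding inner_vec_def inner_real_def by (simp only: sum.neutral_const)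
    then show ?thesis using objective_ge_tangent[of A b "x k" "x l"] by (simp add: r_eq g_eq)
  qed
  have "r (x n) = r (x n')"
    by (intro order_antisym *) (use assms in auto)
  then show ?thesis using constant_between[of n n'] constant_between[of n' n] by force
qed

section \<open>Stationarity of accumulation points\<close>

lemma accumulation_point_stationary:
  assumes "0 < s" "accumulation_point x z"
  shows "\<exists>a>0. stationary (feasible s) (objective A b) a z"
proof -
  from assms(2) obtain \<phi> :: "nat \<Rightarrow> nat" where \<phi>: "strict_mono \<phi>" and lim: "(\<lambda>k. x (\<phi> k)) \<longlonglongrightarrow> z"
    by (auto simp: accumulation_point_def o_def)
  have z: "z \<in> feasible s"
    using closed_sequentially[OF closed_feasible _ lim] feas by blast
  then have nonneg: "0 \<le> z $ i" for i by (simp add: mem_feasible_iff)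
  have glim: "(\<lambda>k. g (x (\<phi> k))) \<longlonglongrightarrow> g z"
    unfolding g_eq by (rule isCont_tendsto_compose[OF isCont_gradient_objective lim])
  have Dlim: "(\<lambda>k. D (\<phi> k)) \<longlonglongrightarrow> 0"
    using LIMSEQ_subseq_LIMSEQ[OF D_tendsto_0 \<phi>] by (simp add: o_def)
  have "(\<lambda>k. x (\<phi> k) + (x (Suc (\<phi> k)) - x (\<phi> k))) \<longlonglongrightarrow> z + 0"
    using LIMSEQ_subseq_LIMSEQ[OF increment_tendsto_0 \<phi>] by (intro tendsto_add lim) (simp add: o_def)
  then have "(\<lambda>k. x (Suc (\<phi> k))) \<longlonglongrightarrow> z" by simp
  from eventually_pos_on_supp[OF this nonneg]
  have ev_next: "eventually (\<lambda>k. supp z \<subseteq> supp (x (Suc (\<phi> k)))) sequentially"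
    by eventually_elim (auto simp: supp_def)
  \<comment> \<open>Eventually \<open>i\<close> lies in the support of the next iterate, where the
    gradient is \<open>- D\<close>, which tends to 0.\<close>
  have zero: "g z $ i = 0" if "i \<in> supp z" for i
  proof -
    have "eventually (\<lambda>k. g (x (\<phi> k)) $ i = - D (\<phi> k) $ i) sequentially"
      using ev_next by eventually_elim (use that gradient_on_supp in blast)
    moreover have "(\<lambda>k. - D (\<phi> k) $ i) \<longlonglongrightarrow> - 0 $ i"
      by (intro tendsto_minus tendsto_vec_nth Dlim)
    ultimately have "(\<lambda>k. g (x (\<phi> k)) $ i) \<longlonglongrightarrow> 0"
      by (subst tendsto_cong) auto
    with tendsto_vec_nth[OF glim] show ?thesis by (rule LIMSEQ_unique)
  qed
  have "0 \<le> g z $ j" if lt: "card (supp z) < s" for j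
  proof (rule ccontr)
    assume neg: "\<not> 0 \<le> g z $ j"
    define \<epsilon> where "\<epsilon> = - g z $ j / 2"
    have \<epsilon>: "0 < \<epsilon>" using neg by (simp add: \<epsilon>_def)
    \<comment> \<open>Chosen so that \<open>\<alpha> n * (\<epsilon> / 2) < \<delta>\<close> yields
      both stepsize bounds of \<open>short_step_same_supp\<close>.\<close>
    define \<delta> where "\<delta> = \<epsilon> / 2 * min a0 (\<sigma> / 2)"
    have \<delta>: "0 < \<delta>" using \<epsilon> a0 \<sigma> by (simp add: \<delta>_def)
    have ev1: "eventually (\<lambda>k. g (x (\<phi> k)) $ j < - \<epsilon>) sequentially"
      using neg by (intro order_tendstoD(2)[OF tendsto_vec_nth[OF glim]]) (simp add: \<epsilon>_def)
    have ev2: "eventually (\<lambda>k. norm (D (\<phi> k)) < \<epsilon> / 2) sequentially"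
      using \<epsilon> by (intro order_tendstoD(2)[OF tendsto_norm_zero[OF Dlim]]) simp
    have "eventually (\<lambda>k. i \<notin> supp z \<longrightarrow> x (\<phi> k) $ i < \<delta>) sequentially" for i
      using \<delta> order_tendstoD(2)[OF tendsto_vec_nth[OF lim], of i \<delta>] by (cases "i \<in> supp z") (auto simp: supp_def)
    then have ev3: "eventually (\<lambda>k. \<forall>i. i \<notin> supp z \<longrightarrow> x (\<phi> k) $ i < \<delta>) sequentially"
      by (simp add: eventually_all_finite)
    \<comment> \<open>Since \<open>j\<close> is not selected, \<open>s\<close> coordinates of the new point exceed \<open>\<epsilon> \<alpha>\<close>, and they were
      positive before the step. One of them is small, so \<open>\<alpha>\<close> is small.\<close>
    have "eventually (\<lambda>k. card (supp (x (\<phi> k))) = s \<and> (\<forall>i\<in>supp (x (\<phi> k)). g (x (\<phi> k)) $ i = 0)) sequentially"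
      using ev1 ev2 ev3
    proof eventually_elim
      case (elim k)
      define n where "n = \<phi> k"
      have D_le: "\<bar>D n $ i\<bar> < \<epsilon> / 2" for i
        using component_le_norm_cart[of "D n" i] elim(2) by (simp add: n_def)
      \<comment> \<open>If \<open>j\<close> were selected, the partial derivative would be
        \<open>- D n $ j\<close>, of size below \<open>\<epsilon> / 2\<close>, yet it is less than
        \<open>- \<epsilon>\<close>.\<close>
      have j: "j \<notin> supp (x (Suc n))"
        using gradient_on_supp[of j n] elim(1) D_le[of j] \<epsilon> by (auto simp: n_def)
      have "\<alpha> n * g (x n) $ j < \<alpha> n * (- \<epsilon>)"
        using elim(1) \<alpha>(1)[of n] unfolding n_def by (intro mult_strict_left_mono)
      moreover have "0 \<le> x n $ j" using feas by (simp add: mem_feasible_iff)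
      ultimately have u: "\<alpha> n * \<epsilon> \<le> (x n - \<alpha> n *\<^sub>R g (x n)) $ j" by simp
      have u_pos: "0 < (x n - \<alpha> n *\<^sub>R g (x n)) $ j"
        by (rule less_le_trans[OF _ u]) (use \<alpha> \<epsilon> in simp)
      have card: "card (supp (x (Suc n))) = s"
        by (rule proj_feasible_saturated[OF step j u_pos])
      have ge: "\<alpha> n * (\<epsilon> / 2) \<le> x n $ i" if "i \<in> supp (x (Suc n))" for i
      proof -
        have "\<alpha> n * \<epsilon> \<le> x (Suc n) $ i"
          using proj_feasible_ge[OF step j u_pos that] u by linarith
        moreover have "x (Suc n) $ i - x n $ i = \<alpha> n * D n $ i"
          using arg_cong[OF increment[of n], of "\<lambda>v. v $ i"] by simp
        moreover have "\<alpha> n * D n $ i \<le> \<alpha> n * (\<epsilon> / 2)"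
          using D_le[of i] \<alpha>(1)[of n] by (intro mult_left_mono) auto
        ultimately show ?thesis by simp
      qed
      have "supp (x (Suc n)) \<subseteq> supp (x n)"
      proof
        fix i assume "i \<in> supp (x (Suc n))"
        moreover have "0 < \<alpha> n * (\<epsilon> / 2)" using \<alpha> \<epsilon> by simp
        ultimately have "0 < x n $ i" using ge by (meson less_le_trans)
        then show "i \<in> supp (x n)" by (simp add: supp_def)
      qed
      then have same: "supp (x (Suc n)) = supp (x n)"
        using feas[of n] card by (intro card_seteq) (auto simp: mem_feasible_iff)
      have "\<not> supp (x (Suc n)) \<subseteq> supp z"
        using lt card card_mono[of "supp z" "supp (x (Suc n))"] by auto
      then obtain i where i: "i \<in> supp (x (Suc n))" "i \<notin> supp z" by blast
      have "\<alpha> n * (\<epsilon> / 2) < \<delta>" using ge[OF i(1)] elim(3) i(2) by (force simp: n_def)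
      then have "\<alpha> n < min a0 (\<sigma> / 2)" using \<epsilon> by (simp add: \<delta>_def mult.commute)
      then have stay: "x (Suc n) = x n" using same by (intro short_step_same_supp) auto
      then have "D n = 0" by (simp add: D_def)
      with stay card gradient_on_supp[of _ n] show ?case by (simp add: n_def)
    qed
    then obtain K where K: "\<And>k. K \<le> k \<Longrightarrow> card (supp (x (\<phi> k))) = s"
      "\<And>k i. K \<le> k \<Longrightarrow> i \<in> supp (x (\<phi> k)) \<Longrightarrow> g (x (\<phi> k)) $ i = 0"
      unfolding eventually_sequentially by blast
    \<comment> \<open>Only finitely many supports are available, and each determines a critical value of \<open>r\<close>.\<close>
    have "\<exists>k0\<in>{K..}. infinite {k \<in> {K..}. supp (x (\<phi> k)) = supp (x (\<phi> k0))}"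
      by (rule pigeonhole_infinite) (auto simp: infinite_Ici)
    then obtain k0 where k0: "K \<le> k0" and inf: "infinite {k \<in> {K..}. supp (x (\<phi> k)) = supp (x (\<phi> k0))}"
      by auto
    have const: "x (\<phi> k) = x (\<phi> k0)" if "K \<le> k" "supp (x (\<phi> k)) = supp (x (\<phi> k0))" for k
      using that k0 K(2) by (intro critical_on_same_supp) auto
    \<comment> \<open>The subsequence takes the value \<open>x (\<phi> k0)\<close> infinitely often,
      so its limit is that value. Then \<open>z\<close> would have \<open>s\<close> nonzero entries,
      contradicting \<open>lt\<close>.\<close>
    have "z = x (\<phi> k0)"
    proof (rule ccontr)
      assume "z \<noteq> x (\<phi> k0)"
      then have "eventually (\<lambda>k. x (\<phi> k) \<noteq> x (\<phi> k0)) sequentially"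
        using tendsto_imp_eventually_ne[OF lim] by blast
      then obtain K' where K': "\<And>k. K' \<le> k \<Longrightarrow> x (\<phi> k) \<noteq> x (\<phi> k0)"
        unfolding eventually_sequentially by blast
      have "{k \<in> {K..}. supp (x (\<phi> k)) = supp (x (\<phi> k0))} \<subseteq> {..<K'}"
        using K' const not_le by blast
      with inf show False using finite_subset by blast
    qed
    with K(1)[OF k0] lt show False by simp
  qed
  then have "card (supp z) = s \<or> (\<forall>i. 0 \<le> g z $ i)"
    using z by (auto simp: mem_feasible_iff order_le_less)
  with zero show ?thesis
    unfolding g_eq by (intro stationary_feasible[OF z assms(1)])
qed

end

section \<open>From runs of the algorithm to projected gradient steps\<close>

lemma gspa_sequence_imp_steps:
  fixes A :: "real ^ 'n ^ 'm"
  assumes "0 < lambda_max (transpose A ** A)" "0 < a0" "a0 < 1 / lambda_max (transpose A ** A)"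
    and "0 < \<sigma>" "0 < \<beta>" "\<beta> < 1" and seq: "gspa_sequence A b s a0 \<sigma> \<beta> x \<alpha>"
  shows "gspa_steps A b s a0 \<sigma> x \<alpha> (objective A b) (gradient (objective A b))"
proof -
  define r where "r = objective A b"
  define P where "P n t = proj_set (feasible s) (x n - t *\<^sub>R gradient r (x n))" for n t
  have x0: "x 0 = 0"
    using seq by (simp add: gspa_sequence_def Let_def)
  from seq obtain \<Gamma> xt y where
    all: "\<forall>k. xt k \<in> P k a0 \<and> (\<forall>t>0. y k t \<in> P k t) \<and>
             (if supp (xt k) = \<Gamma> k
              then \<alpha> k = a0 \<and> x (Suc k) = xt k
              else let accept = (\<lambda>m. sufficient_decrease r \<sigma> (x k) (a0 * \<beta> ^ m) (y k (a0 * \<beta> ^ m)))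
                   in (\<exists>m>0. accept m) \<and>
                      \<alpha> k = a0 * \<beta> ^ (LEAST m. 0 < m \<and> accept m) \<and>
                      x (Suc k) = y k (\<alpha> k)) \<and>
             \<Gamma> (Suc k) = supp (x (Suc k))"
    unfolding gspa_sequence_def Let_def P_def r_def by blast
  have main: "x (Suc n) \<in> P n (\<alpha> n) \<and> 0 < \<alpha> n \<and> \<alpha> n \<le> a0 \<and>
      (\<alpha> n = a0 \<or> sufficient_decrease r \<sigma> (x n) (\<alpha> n) (x (Suc n)))" for n
  proof (cases "supp (xt n) = \<Gamma> n")
    case True
    then show ?thesis using all[rule_format, of n] assms(2) by simp
  next
    case False
    \<comment> \<open>Positivity of \<open>m\<close> is part of \<open>Q\<close>, so that
      \<open>LEAST m. Q m\<close> is the exponent used by the algorithm and satisfies the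
      test.\<close>
    define Q where "Q m \<longleftrightarrow> 0 < m \<and> sufficient_decrease r \<sigma> (x n) (a0 * \<beta> ^ m) (y n (a0 * \<beta> ^ m))" for m
    have y: "\<forall>t>0. y n t \<in> P n t" and ex: "\<exists>m. Q m" and \<alpha>: "\<alpha> n = a0 * \<beta> ^ (LEAST m. Q m)"
      and x: "x (Suc n) = y n (\<alpha> n)"
      using all[rule_format, of n] False by (auto simp: Let_def Q_def)
    have "Q (LEAST m. Q m)" using ex by (rule LeastI_ex)
    then have "sufficient_decrease r \<sigma> (x n) (\<alpha> n) (x (Suc n))" by (simp add: Q_def \<alpha> x)
    moreover have "0 < \<alpha> n" using assms(2,5) by (simp add: \<alpha>)
    moreover have "\<alpha> n \<le> a0" using assms(2,5,6) by (simp add: \<alpha> mult_left_le power_le_one)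
    ultimately show ?thesis using y x by simp
  qed
  have "x n \<in> feasible s" for n
    using main x0 by (cases n) (auto simp: mem_feasible_iff supp_def P_def proj_set_iff)
  then show ?thesis
    using main assms(1-4) by unfold_locales (auto simp: P_def r_def field_simps)
qed

theorem theorem4p1:
  fixes A :: "real ^ 'n ^ 'm" and b :: "real ^ 'm" and s :: nat
    and a0 \<sigma> \<beta> :: real and x :: "nat \<Rightarrow> real ^ 'n" and \<alpha> :: "nat \<Rightarrow> real"
  assumes "0 < s" and "s < CARD('m)" and "CARD('m) < CARD('n)"
    and "0 < lambda_max (transpose A ** A)"
    and "0 < a0" and "a0 < 1 / lambda_max (transpose A ** A)"
    and "0 < \<sigma>" and "\<sigma> \<le> 1 / (4 * lambda_max (transpose A ** A))"
    and "0 < \<beta>" and "\<beta> < 1"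
    and "gspa_sequence A b s a0 \<sigma> \<beta> x \<alpha>"
  shows "(\<lambda>k. norm (x (Suc k) - x k) / \<alpha> k) \<longlonglongrightarrow> 0 \<and>
         (\<forall>z. accumulation_point x z \<longrightarrow>
            (\<exists>a>0. stationary (feasible s) (objective A b) a z)) \<and>
         (\<lambda>k. norm (clarke_gradient (feasible s) (objective A b) (x k))) \<longlonglongrightarrow> 0"
proof -
  interpret gspa_steps A b s a0 \<sigma> x \<alpha> "objective A b" "gradient (objective A b)"
    by (rule gspa_sequence_imp_steps[OF assms(4-7,9-11)])
  have "norm (x (Suc k) - x k) / \<alpha> k = norm (D k)" for k
    using \<alpha>(1)[of k] by (simp add: D_def)
  then have "(\<lambda>k. norm (x (Suc k) - x k) / \<alpha> k) \<longlonglongrightarrow> 0"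
    using tendsto_norm_zero[OF D_tendsto_0] by simp
  then show ?thesis
    using accumulation_point_stationary clarke_gradient_tendsto_0 assms(1-3) by simp
qed

end
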